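(* Let $T\in\mathcal T_n$, and write $d_T(i)$ for the degree of the vertex $i$ in $T$. For every $m\ge n$, $$C_1(T;m)=\binom{m}{n}\sum_{\substack{b_1+\cdots+b_n=m\\ b_i\ge1}}\binom{m-n}{b_1-1,\ldots,b_n-1}\prod_{i=1}^n b_i^{\,b_i-2+d_T(i)},$$ where the sum is over $n$-tuples $(b_1,\dots,b_n)$ of positive integers with sum $m$.
   Context: $[m]=\{1,\dots,m\}$, and $\mathcal T_m$ is the set of trees with vertex set $[m]$ (labeled trees). Let $T\in\mathcal T_n$, $U\in\mathcal T_m$. A display of $T$ in $U$ is a pair $(R,q)$ where $R=\{r_1<\cdots<r_n\}\subseteq[m]$ is an $n$-element set and $q:[m]\to R$ is a retraction ($q(r)=r$ for $r\in R$) such that (1) every fiber $q^{-1}(r_i)$ induces a connected subtree of $U$; (2) after each fiber is contracted to one vertex, the quotient tree, with the vertex coming from $q^{-1}(r_i)$ labeled $i$, is equal to $T$. $c_T(U)$ is the number of displays of $T$ in $U$, and $C_1(T;m)=\sum_{U\in\mathcal T_m}c_T(U)$. In the formula, $\binom{m-n}{b_1-1,\ldots,b_n-1}$ is a multinomial coefficient, and powers of $1$ (including with negative exponent) equal $1$. *)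

theory Defs
  imports Complex_Main "HOL-Library.FuncSet"
begin

text \<open>
  A finite simple graph is given by a vertex set \<open>V\<close> and a set \<open>E\<close> of two-element subsets of \<open>V\<close>.
  The digraph-based \<open>tree\<close> of the AFP entry Graph-Theory only excludes directed cycles (and counts
  a pair of opposite arcs as a cycle), so it is not the notion of an undirected tree.
\<close>

definition simple_graph :: "'a set \<Rightarrow> 'a set set \<Rightarrow> bool" where
  "simple_graph V E \<longleftrightarrow> finite V \<and> (\<forall>e\<in>E. e \<subseteq> V \<and> card e = 2)"

definition connected_graph :: "'a set \<Rightarrow> 'a set set \<Rightarrow> bool" where
  "connected_graph V E \<longleftrightarrow> V \<noteq> {} \<and> (\<forall>u\<in>V. \<forall>v\<in>V. (u, v) \<in> {(x, y). {x, y} \<in> E}\<^sup>*)"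

definition is_cycle :: "'a set set \<Rightarrow> 'a list \<Rightarrow> bool" where
  "is_cycle E vs \<longleftrightarrow> length vs \<ge> 3 \<and> distinct vs \<and>
     (\<forall>i<length vs. {vs ! i, vs ! (Suc i mod length vs)} \<in> E)"

definition tree_graph :: "'a set \<Rightarrow> 'a set set \<Rightarrow> bool" where
  "tree_graph V E \<longleftrightarrow> simple_graph V E \<and> connected_graph V E \<and> (\<nexists>vs. is_cycle E vs)"

text \<open>
  A labeled tree on \<open>{1..m}\<close> is identified with its edge set. There is none for \<open>m = 0\<close>, as a tree
  has at least one vertex.
\<close>

definition labeled_trees :: "nat \<Rightarrow> nat set set set" where
  "labeled_trees m = {E. tree_graph {1..m} E}"

definition degree :: "'a set set \<Rightarrow> 'a \<Rightarrow> nat" where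
  "degree E v = card {e \<in> E. v \<in> e}"

definition induced_edges :: "'a set set \<Rightarrow> 'a set \<Rightarrow> 'a set set" where
  "induced_edges E W = {e \<in> E. e \<subseteq> W}"

text \<open>The element \<open>r\<^sub>i\<close> of \<open>R = {r\<^sub>1 < \<dots> < r\<^sub>n}\<close>, counting from \<open>1\<close>.\<close>

definition nth_element :: "nat set \<Rightarrow> nat \<Rightarrow> nat" where
  "nth_element R i = sorted_list_of_set R ! (i - 1)"

text \<open>The fiber is taken in \<open>{1..m}\<close>, the domain of \<open>q\<close>.\<close>

definition fiber :: "nat \<Rightarrow> (nat \<Rightarrow> nat) \<Rightarrow> nat \<Rightarrow> nat set" where
  "fiber m q r = {v \<in> {1..m}. q v = r}"

text \<open>
  Edge set, on the vertex set \<open>{1..card R}\<close>, of the graph obtained by contracting each fiber of \<open>q\<close>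
  to one vertex, the fiber over \<open>r\<^sub>i\<close> becoming the vertex \<open>i\<close>. Loops are dropped; parallel edges cannot
  arise when \<open>U\<close> is a tree and the fibers are connected.
\<close>

definition contracted_edges :: "nat \<Rightarrow> nat set \<Rightarrow> (nat \<Rightarrow> nat) \<Rightarrow> nat set set \<Rightarrow> nat set set" where
  "contracted_edges m R q U =
     {{i, j} | i j. i \<in> {1..card R} \<and> j \<in> {1..card R} \<and> i \<noteq> j \<and>
        (\<exists>u \<in> fiber m q (nth_element R i). \<exists>v \<in> fiber m q (nth_element R j). {u, v} \<in> U)}"

text \<open>
  Maps \<open>q\<close> from \<open>{1..m}\<close> to \<open>R\<close> are taken in the extensional function space, so that each such map is
  represented, and hence counted, exactly once.
\<close>

definition displays :: "nat \<Rightarrow> nat set set \<Rightarrow> nat \<Rightarrow> nat set set \<Rightarrow> (nat set \<times> (nat \<Rightarrow> nat)) set" where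
  "displays n T m U =
     {(R, q). R \<subseteq> {1..m} \<and> card R = n \<and>
        q \<in> {1..m} \<rightarrow>\<^sub>E R \<and> (\<forall>r\<in>R. q r = r) \<and>
        (\<forall>r\<in>R. tree_graph (fiber m q r) (induced_edges U (fiber m q r))) \<and>
        contracted_edges m R q U = T}"

definition display_count :: "nat \<Rightarrow> nat set set \<Rightarrow> nat \<Rightarrow> nat set set \<Rightarrow> nat" where
  "display_count n T m U = card (displays n T m U)"

definition C1 :: "nat \<Rightarrow> nat set set \<Rightarrow> nat \<Rightarrow> nat" where
  "C1 n T m = (\<Sum>U\<in>labeled_trees m. display_count n T m U)"

definition multinomial :: "nat \<Rightarrow> 'i set \<Rightarrow> ('i \<Rightarrow> nat) \<Rightarrow> real" where
  "multinomial N I k = fact N / (\<Prod>i\<in>I. fact (k i))"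

definition compositions :: "nat \<Rightarrow> nat \<Rightarrow> (nat \<Rightarrow> nat) set" where
  "compositions m n = {b \<in> {1..n} \<rightarrow>\<^sub>E {1..}. (\<Sum>i=1..n. b i) = m}"

text \<open>The sums and cardinalities above range over finite sets.\<close>

lemma finite_labeled_trees: "finite (labeled_trees m)"
  by (rule finite_subset[of _ "Pow (Pow {1..m})"])
     (auto simp: labeled_trees_def tree_graph_def simple_graph_def)

lemma finite_displays: "finite (displays n T m U)"
proof (rule finite_subset)
  show "displays n T m U \<subseteq> (SIGMA R:Pow {1..m}. {1..m} \<rightarrow>\<^sub>E R)"
    by (auto simp: displays_def)
  show "finite (SIGMA R:Pow {1..m}. {1..m} \<rightarrow>\<^sub>E R)"
    by (intro finite_SigmaI finite_PiE) (auto intro: finite_subset)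
qed

lemma finite_compositions: "finite (compositions m n)"
proof (rule finite_subset)
  show "compositions m n \<subseteq> {1..n} \<rightarrow>\<^sub>E {..m}"
  proof
    fix b assume b: "b \<in> compositions m n"
    have "b i \<le> m" if "i \<in> {1..n}" for i
      using b member_le_sum[of i "{1..n}" b] that by (auto simp: compositions_def)
    with b show "b \<in> {1..n} \<rightarrow>\<^sub>E {..m}"
      by (auto simp: compositions_def PiE_def)
  qed
qed (intro finite_PiE, auto)

end

theory Submission
  imports Defs
begin

text \<open>
  Exchange the order of counting: fix \<open>R\<close> and \<open>q\<close> and count the trees \<open>U\<close> that contract to \<open>T\<close> along
  \<open>q\<close>. Let \<open>b\<^sub>i\<close> be the size of the fiber over the \<open>i\<close>-th element of \<open>R\<close>. Such a \<open>U\<close> consists of a tree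
  on each fiber and, for each edge \<open>{i, j}\<close> of \<open>T\<close>, exactly one edge joining the two fibers, and all
  these pieces can be chosen independently. By Cayley's formula a fiber contributes
  \<open>b\<^sub>i ^ (b\<^sub>i - 2)\<close>, while an edge contributes \<open>b\<^sub>i b\<^sub>j\<close>; the product over the edges of \<open>T\<close> collects
  \<open>b\<^sub>i\<close> to the power of the degree of \<open>i\<close> (\<open>card_glued_trees\<close>). For fixed \<open>R\<close> the map \<open>q\<close> is an
  arbitrary map on the complement of \<open>R\<close>, so the fiber sizes \<open>b\<close> occur a multinomial number of times
  (\<open>card_retractions_with_fiber_sizes\<close>), and the choice of \<open>R\<close> gives the binomial coefficient.

  That the pieces glue to a tree, and that a tree splits into such pieces, both rest on the
  criterion \<open>tree_iff_connected_card\<close>: a graph is a tree iff it is connected and has one edge less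
  than vertices. Gluing connected pieces along a connected graph is plainly connected, so only edges
  have to be counted (\<open>glued_trees_piecewise\<close>).

  Cayley's formula (\<open>cayley\<close>) is proved by comparing two unions. On \<open>n \<ge> 3\<close> vertices every tree has
  a leaf, and every word of length \<open>n - 2\<close> over the vertices misses a letter. The trees in which all
  vertices of a set \<open>J\<close> of size \<open>j\<close> are leaves arise from the trees on the other vertices by attaching
  each element of \<open>J\<close> to one of these, so by induction there are
  \<open>(n - j) ^ j * (n - j) ^ (n - j - 2) = (n - j) ^ (n - 2)\<close> of them: as many as there are words
  avoiding \<open>J\<close>. (If \<open>J\<close> contains all vertices, both numbers are zero.)
  By inclusion-exclusion the unions have equal size too.
\<close>

section \<open>Leaves and the edge count of a tree\<close>

abbreviation adj :: "'a set set \<Rightarrow> ('a \<times> 'a) set" where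
  "adj E \<equiv> {(x, y). {x, y} \<in> E}"

lemma simple_graph_finite: "simple_graph V E \<Longrightarrow> finite V \<and> finite E"
  unfolding simple_graph_def by (meson Pow_iff finite_Pow_iff finite_subset subsetI)

lemma edge_other_end:
  assumes "card e = 2" "v \<in> e"
  obtains w where "w \<noteq> v" "e = {v, w}"
proof -
  obtain x y where "e = {x, y}" "x \<noteq> y" using assms(1) by (auto simp: card_2_iff)
  then show ?thesis using assms(2) that[of x] that[of y] by auto
qed

lemma simple_graph_insert_leaf:
  assumes "v \<notin> V" "w \<in> V"
  shows "simple_graph V E \<Longrightarrow> simple_graph (insert v V) (insert {v, w} E)"
  using assms unfolding simple_graph_def by (auto simp: card_insert_if)

lemma connected_insert_leaf:
  assumes "simple_graph V E" and v: "v \<notin> V" and w: "w \<in> V"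
  shows "connected_graph (insert v V) (insert {v, w} E) \<longleftrightarrow> connected_graph V E"
proof
  assume c: "connected_graph V E"
  let ?A = "(adj (insert {v, w} E))\<^sup>*"
  have old: "(a, b) \<in> ?A" if "a \<in> V" "b \<in> V" for a b
    using c that rtrancl_mono[of "adj E" "adj (insert {v, w} E)"]
    unfolding connected_graph_def by blast
  have vw: "(v, w) \<in> ?A" "(w, v) \<in> ?A"
    by (auto simp: insert_commute)
  have "(a, b) \<in> ?A" if "a \<in> insert v V" "b \<in> insert v V" for a b
  proof -
    have "(a, w) \<in> ?A" using that(1) old[of a w] vw w by auto
    moreover have "(w, b) \<in> ?A" using that(2) old[of w b] vw w by auto
    ultimately show ?thesis by (rule rtrancl_trans)
  qed
  then show "connected_graph (insert v V) (insert {v, w} E)"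
    unfolding connected_graph_def by blast
next
  assume c: "connected_graph (insert v V) (insert {v, w} E)"
  have E: "e \<subseteq> V" if "e \<in> E" for e using assms that by (auto simp: simple_graph_def)
  have "(a, b) \<in> (adj E)\<^sup>*" if a: "a \<in> V" and b: "b \<in> V" for a b
  proof -
    have "(a, b) \<in> (adj (insert {v, w} E))\<^sup>*"
      using c a b unfolding connected_graph_def by blast
    \<comment> \<open>A walk that steps onto \<open>v\<close> came from \<open>w\<close> and returns to \<open>w\<close>, so cut the detour.\<close>
    then have "(a, if b = v then w else b) \<in> (adj E)\<^sup>*"
    proof (induction rule: rtrancl_induct)
      case base
      then show ?case using a v by auto
    next
      case (step x y)
      show ?case
      proof (cases "{x, y} = {v, w}")
        case True
        then show ?thesis using step.IH v w by (auto simp: doubleton_eq_iff split: if_splits)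
      next
        case False
        then have e: "{x, y} \<in> E" using step by auto
        then have "x \<noteq> v" "y \<noteq> v" using E v by auto
        then show ?thesis using step.IH e by (auto intro: rtrancl_into_rtrancl)
      qed
    qed
    then show ?thesis using b v by (auto split: if_splits)
  qed
  then show "connected_graph V E" using w unfolding connected_graph_def by blast
qed

text \<open>
  The two neighbours of a vertex on a cycle are distinct, since a cycle has length at least three;
  a vertex whose only neighbour is \<open>w\<close> therefore lies on no cycle.
\<close>
lemma cycle_avoids_leaf:
  assumes cyc: "is_cycle (insert {v, w} E) vs" and v: "v \<notin> \<Union>E" and "v \<noteq> w"
  shows "is_cycle E vs"
proof -
  let ?n = "length vs"
  have n: "?n \<ge> 3" and d: "distinct vs" using cyc by (auto simp: is_cycle_def)
  have e: "{vs ! i, vs ! (Suc i mod ?n)} \<in> insert {v, w} E" if "i < ?n" for i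
    using cyc that unfolding is_cycle_def by blast
  have "v \<notin> set vs"
  proof
    assume "v \<in> set vs"
    then obtain i where i: "i < ?n" "vs ! i = v" by (auto simp: in_set_conv_nth)
    \<comment> \<open>The cyclic predecessor of \<open>i\<close>.\<close>
    define j where "j = (if i = 0 then ?n - 1 else i - 1)"
    have j: "j < ?n" "Suc j mod ?n = i" using i n by (auto simp: j_def)
    have s: "Suc i mod ?n < ?n" using n mod_less_divisor[of ?n "Suc i"] by linarith
    have "vs ! (Suc i mod ?n) = w"
      using e[OF i(1)] i v by (auto simp: doubleton_eq_iff)
    moreover have "vs ! j = w"
      using e[OF j(1)] j i v by (auto simp: doubleton_eq_iff)
    ultimately have "j = Suc i mod ?n"
      using d j s by (metis nth_eq_iff_index_eq)
    then show False
      using i n by (cases "Suc i = ?n") (auto simp: j_def split: if_splits)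
  qed
  then have "{vs ! i, vs ! (Suc i mod ?n)} \<in> E" if "i < ?n" for i
  proof -
    have "Suc i mod ?n < ?n" using n mod_less_divisor[of ?n "Suc i"] by linarith
    then have "vs ! i \<noteq> v" "vs ! (Suc i mod ?n) \<noteq> v" using \<open>v \<notin> set vs\<close> that nth_mem by blast+
    then show ?thesis using e[OF that] by (auto simp: doubleton_eq_iff)
  qed
  then show ?thesis using n d by (simp add: is_cycle_def)
qed

lemma is_cycle_mono: "is_cycle E vs \<Longrightarrow> E \<subseteq> F \<Longrightarrow> is_cycle F vs"
  unfolding is_cycle_def by blast

text \<open>
  Attaching or removing a leaf changes neither connectedness nor the existence of cycles.
\<close>
lemma tree_insert_leaf:
  assumes s: "simple_graph V E" and v: "v \<notin> V" and w: "w \<in> V"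
  shows "tree_graph (insert v V) (insert {v, w} E) \<longleftrightarrow> tree_graph V E"
proof -
  have "v \<notin> \<Union>E" "v \<noteq> w" using s v w by (auto simp: simple_graph_def)
  then have "(\<exists>vs. is_cycle (insert {v, w} E) vs) \<longleftrightarrow> (\<exists>vs. is_cycle E vs)"
    using cycle_avoids_leaf is_cycle_mono by (metis subset_insertI)
  then show ?thesis
    using connected_insert_leaf[OF assms] simple_graph_insert_leaf[OF v w s] s
    by (simp add: tree_graph_def)
qed

lemma leaf_decomposition:
  assumes s: "simple_graph V E" and "degree E v = 1"
  obtains w E' where "v \<in> V" "w \<in> V - {v}" "E = insert {v, w} E'" "simple_graph (V - {v}) E'"
    "{v, w} \<notin> E'"
proof -
  obtain e where e: "{e \<in> E. v \<in> e} = {e}"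
    using assms(2) unfolding degree_def by (auto simp: card_1_singleton_iff)
  then have "e \<in> E" "v \<in> e" by auto
  then have "card e = 2" using s by (simp add: simple_graph_def)
  then obtain w where w: "e = {v, w}" "w \<noteq> v" using \<open>v \<in> e\<close> by (rule edge_other_end)
  show ?thesis
  proof
    show "v \<in> V" "w \<in> V - {v}" using \<open>e \<in> E\<close> w s by (auto simp: simple_graph_def)
    show "E = insert {v, w} (E - {e})" using \<open>e \<in> E\<close> w by auto
    show "{v, w} \<notin> E - {e}" using w by auto
    have "v \<notin> e'" if "e' \<in> E - {e}" for e' using e that by blast
    then show "simple_graph (V - {v}) (E - {e})" using s unfolding simple_graph_def by blast
  qed
qed

lemma connected_degree_pos:
  assumes s: "simple_graph V E" and c: "connected_graph V E" and v: "v \<in> V" and "card V \<ge> 2"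
  shows "degree E v \<ge> 1"
proof -
  obtain u where u: "u \<in> V" "u \<noteq> v" using assms(4) v
    by (metis One_nat_def Suc_1 card.empty card.insert empty_iff finite.emptyI is_singletonI'
        is_singleton_altdef not_less_eq_eq order_refl)
  then have "(v, u) \<in> (adj E)\<^sup>*" using c v by (auto simp: connected_graph_def)
  then obtain x where "{v, x} \<in> E" using u by (auto elim: converse_rtranclE)
  then have "{e \<in> E. v \<in> e} \<noteq> {}" by auto
  moreover have "finite {e \<in> E. v \<in> e}" using simple_graph_finite[OF s] by auto
  ultimately show ?thesis by (simp add: degree_def card_gt_0_iff Suc_le_eq)
qed

lemma handshake:
  assumes "simple_graph V E"
  shows "(\<Sum>v\<in>V. degree E v) = 2 * card E"
proof -
  have "card {v \<in> V. v \<in> e} = 2" if "e \<in> E" for e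
  proof -
    have "{v \<in> V. v \<in> e} = e" using that assms by (auto simp: simple_graph_def)
    then show ?thesis using that assms by (auto simp: simple_graph_def)
  qed
  then show ?thesis
    using sum_multicount_gen[of V E "\<lambda>v e. v \<in> e" "\<lambda>_. 2"] simple_graph_finite[OF assms]
    by (simp add: degree_def)
qed

text \<open>
  Suppose that all degrees are at least two, and take a longest path. A second neighbour of its
  first vertex must lie on the path, which closes a cycle.
\<close>
lemma acyclic_has_leaf:
  assumes s: "simple_graph V E" and "V \<noteq> {}" and pos: "\<And>v. v \<in> V \<Longrightarrow> degree E v \<ge> 1"
    and acyc: "\<nexists>vs. is_cycle E vs"
  shows "\<exists>v\<in>V. degree E v = 1"
proof (rule ccontr)
  assume "\<not> (\<exists>v\<in>V. degree E v = 1)"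
  with pos have deg: "degree E v \<ge> 2" if "v \<in> V" for v
    using that by (metis One_nat_def Suc_1 le_antisym not_less_eq_eq)
  define P where "P xs \<longleftrightarrow> xs \<noteq> [] \<and> distinct xs \<and> set xs \<subseteq> V
      \<and> (\<forall>i. Suc i < length xs \<longrightarrow> {xs ! i, xs ! Suc i} \<in> E)" for xs
  have fin: "finite V" using s by (simp add: simple_graph_def)
  have "length xs \<le> card V" if "P xs" for xs
    using that fin by (metis P_def card_mono distinct_card)
  moreover obtain a where "a \<in> V" using \<open>V \<noteq> {}\<close> by auto
  then have "P [a]" by (simp add: P_def)
  ultimately obtain xs where xs: "P xs" and max: "\<And>ys. P ys \<Longrightarrow> length ys \<le> length xs"
    using ex_has_greatest_nat[of P "[a]" length "Suc (card V)"] by (metis le_imp_less_Suc)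
  define v where "v = hd xs"
  have v: "v \<in> V" "xs ! 0 = v" using xs by (auto simp: P_def v_def hd_conv_nth)
  obtain y where y: "{v, y} \<in> E" "length xs \<ge> 2 \<Longrightarrow> y \<noteq> xs ! 1"
  proof -
    have "\<not> {e \<in> E. v \<in> e} \<subseteq> {{v, xs ! 1}}"
      using deg[OF v(1)] card_mono[of "{{v, xs ! 1}}" "{e \<in> E. v \<in> e}"]
      by (auto simp: degree_def)
    then obtain e where e: "e \<in> E" "v \<in> e" "e \<noteq> {v, xs ! 1}" by auto
    then have "card e = 2" using s by (simp add: simple_graph_def)
    then obtain y where "e = {v, y}" using \<open>v \<in> e\<close> by (rule edge_other_end)
    then show ?thesis using that e by auto
  qed
  then have yV: "y \<in> V" "y \<noteq> v" using s by (auto simp: simple_graph_def)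
  have "y \<in> set xs"
  proof (rule ccontr)
    assume "y \<notin> set xs"
    then have "P (y # xs)" using xs y yV v
      by (auto simp: P_def nth_Cons insert_commute split: nat.splits)
    then show False using max by fastforce
  qed
  then obtain j where j: "j < length xs" "xs ! j = y" by (auto simp: in_set_conv_nth)
  have j2: "j \<ge> 2"
  proof (rule ccontr)
    assume "\<not> j \<ge> 2"
    then have "j = 0 \<or> j = 1" by auto
    then show False using j v yV y by auto
  qed
  have "is_cycle E (take (Suc j) xs)"
    unfolding is_cycle_def
  proof (intro conjI allI impI)
    show "3 \<le> length (take (Suc j) xs)" using j j2 by simp
    show "distinct (take (Suc j) xs)" using xs by (simp add: P_def)
    fix i assume i: "i < length (take (Suc j) xs)"
    have len: "length (take (Suc j) xs) = Suc j" using j by simp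
    show "{take (Suc j) xs ! i, take (Suc j) xs ! (Suc i mod length (take (Suc j) xs))} \<in> E"
    proof (cases "i = j")
      case True
      then show ?thesis unfolding len using j v y by (simp add: insert_commute)
    next
      case False
      then show ?thesis using i j xs unfolding len by (simp add: P_def)
    qed
  qed
  then show False using acyc by blast
qed

lemma tree_has_leaf:
  assumes "tree_graph V E" "card V \<ge> 2"
  shows "\<exists>v\<in>V. degree E v = 1"
proof (rule acyclic_has_leaf)
  show "V \<noteq> {}" using assms(2) by auto
qed (use assms connected_degree_pos in \<open>auto simp: tree_graph_def\<close>)

lemma tree_graph_singleton_iff: "tree_graph {v} E \<longleftrightarrow> E = {}"
proof
  assume t: "tree_graph {v} E"
  have "e \<notin> E" for e
  proof
    assume "e \<in> E"
    then have "e \<subseteq> {v}" "card e = 2" using t by (auto simp: tree_graph_def simple_graph_def)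
    then show False using card_mono[of "{v}" e] by simp
  qed
  then show "E = {}" by auto
next
  assume "E = {}"
  then show "tree_graph {v} E"
    by (auto simp: tree_graph_def simple_graph_def connected_graph_def is_cycle_def
        intro!: exI[of _ 0])
qed

text \<open>
  Induction by removing a leaf, which affects both sides equally. A tree has a leaf since it is
  acyclic; a connected graph with \<open>card V - 1\<close> edges has one since otherwise all degrees would be at
  least two, against the degree sum \<open>2 * (card V - 1)\<close>.
\<close>
lemma tree_iff_connected_card:
  assumes "simple_graph V E"
  shows "tree_graph V E \<longleftrightarrow> connected_graph V E \<and> Suc (card E) = card V"
  using assms
proof (induction "card V" arbitrary: V E rule: less_induct)
  case less
  have fin: "finite V" "finite E" using less.prems simple_graph_finite by auto
  consider "card V = 0" | "card V = 1" | "card V \<ge> 2" by linarith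
  then show ?case
  proof cases
    case 1
    then show ?thesis using fin by (simp add: tree_graph_def connected_graph_def)
  next
    case 2
    then obtain v where "V = {v}" by (auto simp: card_1_singleton_iff)
    then show ?thesis
      using tree_graph_singleton_iff[of v E] fin by (auto simp: tree_graph_def)
  next
    case 3
    have "\<exists>v\<in>V. degree E v = 1" if "tree_graph V E \<or> connected_graph V E \<and> Suc (card E) = card V"
    proof (rule ccontr)
      assume no: "\<not> ?thesis"
      then have c: "connected_graph V E" "Suc (card E) = card V"
        using that tree_has_leaf 3 by auto
      have "degree E v \<ge> 2" if "v \<in> V" for v
        using no that connected_degree_pos[OF less.prems c(1) that 3] by force
      then have "card V * 2 \<le> (\<Sum>v\<in>V. degree E v)" using sum_bounded_below[of V 2 "degree E"] by simp
      then show False using handshake[OF less.prems] c by simp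
    qed
    moreover
    have ?thesis if v: "v \<in> V" "degree E v = 1" for v
    proof -
      obtain w E' where *: "w \<in> V - {v}" "E = insert {v, w} E'" "simple_graph (V - {v}) E'"
          "{v, w} \<notin> E'"
        using leaf_decomposition[OF less.prems v(2)] by metis
      have card: "card V = Suc (card (V - {v}))" using that fin by (metis card_Suc_Diff1)
      have cardE: "card E = Suc (card E')" using * simple_graph_finite by fastforce
      have "tree_graph (V - {v}) E' \<longleftrightarrow> connected_graph (V - {v}) E' \<and> Suc (card E') = card (V - {v})"
        using less.hyps[OF _ *(3)] card by simp
      moreover have "tree_graph V E \<longleftrightarrow> tree_graph (V - {v}) E'"
        using tree_insert_leaf[OF *(3) _ *(1), of v] *(2) v(1) by (simp add: insert_absorb)
      moreover have "connected_graph V E \<longleftrightarrow> connected_graph (V - {v}) E'"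
        using connected_insert_leaf[OF *(3) _ *(1), of v] *(2) v(1) by (simp add: insert_absorb)
      ultimately show ?thesis using card cardE by simp
    qed
    ultimately show ?thesis by blast
  qed
qed

section \<open>Cayley's formula\<close>

text \<open>
  By inclusion-exclusion the size of a union is a function of the sizes of the intersections. Comparing
  two families in this way avoids the evaluation of any alternating sum.
\<close>
lemma card_Union_eq_if_card_Inter_eq:
  assumes "finite I" "\<And>i. i \<in> I \<Longrightarrow> finite (A i)" "\<And>i. i \<in> I \<Longrightarrow> finite (B i)"
    and eq: "\<And>J. J \<subseteq> I \<Longrightarrow> J \<noteq> {} \<Longrightarrow> card (\<Inter>(A ` J)) = card (\<Inter>(B ` J))"
  shows "card (\<Union>(A ` I)) = card (\<Union>(B ` I))"
proof -
  interpret X: Incl_Excl finite "\<lambda>S :: 'b set. int (card S)"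
    by unfold_locales (auto simp: card_Un_disjnt)
  interpret Y: Incl_Excl finite "\<lambda>S :: 'c set. int (card S)"
    by unfold_locales (auto simp: card_Un_disjnt)
  have "int (card (\<Union>(A ` I))) = int (card (\<Union>(B ` I)))"
    using X.restricted_indexed[of I A] Y.restricted_indexed[of I B] assms
    by (auto intro!: sum.cong)
  then show ?thesis by simp
qed

lemma degree_insert_edge:
  assumes "finite E" "{x, w} \<notin> E"
  shows "degree (insert {x, w} E) y = (if y \<in> {x, w} then Suc (degree E y) else degree E y)"
proof -
  have "{e \<in> insert {x, w} E. y \<in> e} =
      (if y \<in> {x, w} then insert {x, w} {e \<in> E. y \<in> e} else {e \<in> E. y \<in> e})"
    by auto
  then show ?thesis using assms by (simp add: degree_def)
qed

lemma tree_leaf_decomposition: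
  assumes t: "tree_graph V E" and "degree E x = 1"
  obtains w E' where "x \<in> V" "w \<in> V - {x}" "E = insert {x, w} E'" "tree_graph (V - {x}) E'"
    "{x, w} \<notin> E'" "finite E'"
proof -
  have "simple_graph V E" using t by (simp add: tree_graph_def)
  from leaf_decomposition[OF this assms(2)]
  obtain w E' where *: "x \<in> V" "w \<in> V - {x}" "E = insert {x, w} E'" "simple_graph (V - {x}) E'"
    "{x, w} \<notin> E'" by blast
  then have "tree_graph (V - {x}) E'"
    using tree_insert_leaf[OF *(4) _ *(2), of x] t by (simp add: insert_absorb)
  then show ?thesis using that * simple_graph_finite by blast
qed

definition trees :: "'a set \<Rightarrow> 'a set set set" where
  "trees V = {E. tree_graph V E}"

definition leaf_trees :: "'a set \<Rightarrow> 'a set \<Rightarrow> 'a set set set" where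
  "leaf_trees V L = {E. tree_graph V E \<and> (\<forall>v\<in>L. degree E v = 1)}"

lemma finite_trees: "finite V \<Longrightarrow> finite (trees V)"
  by (rule finite_subset[of _ "Pow (Pow V)"])
     (auto simp: trees_def tree_graph_def simple_graph_def)

lemma finite_leaf_trees: "finite V \<Longrightarrow> finite (leaf_trees V L)"
  by (rule finite_subset[OF _ finite_trees]) (auto simp: leaf_trees_def trees_def)

lemma tree_degree_pos:
  "tree_graph V E \<Longrightarrow> card V \<ge> 2 \<Longrightarrow> v \<in> V \<Longrightarrow> degree E v \<ge> 1"
  using connected_degree_pos by (auto simp: tree_graph_def)

text \<open>
  The neighbour of a leaf is not a leaf itself: removing the leaf leaves it in a tree with at least two
  vertices, where it still has positive degree.
\<close>
lemma leaf_trees_all_leaves: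
  assumes "card V \<ge> 3"
  shows "leaf_trees V V = {}"
proof (rule ccontr)
  assume "leaf_trees V V \<noteq> {}"
  then obtain E where t: "tree_graph V E" and l: "\<And>v. v \<in> V \<Longrightarrow> degree E v = 1"
    by (auto simp: leaf_trees_def)
  obtain x where "x \<in> V" using assms by fastforce
  with tree_leaf_decomposition[OF t l] obtain w E' where
    *: "w \<in> V - {x}" "E = insert {x, w} E'" "tree_graph (V - {x}) E'" "{x, w} \<notin> E'" "finite E'"
    by metis
  have "card (V - {x}) \<ge> 2" using assms \<open>x \<in> V\<close> by (simp add: card_Diff_singleton_if)
  then have "degree E' w \<ge> 1" using tree_degree_pos[OF *(3) _ *(1)] by simp
  then show False using degree_insert_edge[OF *(5,4), of w] l[of w] * by simp
qed

text \<open>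
  The elements of \<open>L\<close> are attached one at a time, each to one of the vertices of \<open>V\<close>.
\<close>
lemma card_leaf_trees_Un:
  assumes "finite L" "finite V" "V \<inter> L = {}" "V \<noteq> {}"
  shows "card (leaf_trees (V \<union> L) L) = card V ^ card L * card (trees V)"
  using assms
proof (induction L)
  case empty
  then show ?case by (simp add: leaf_trees_def trees_def)
next
  case (insert x L)
  let ?W = "V \<union> L" and ?g = "\<lambda>(w, E). insert {x, w} E"
  have x: "x \<notin> ?W" using insert by auto
  then have W: "insert x ?W - {x} = ?W" by auto
  have fresh: "e \<subseteq> ?W" if "tree_graph ?W E" "e \<in> E" for e E
    using that by (auto simp: tree_graph_def simple_graph_def)
  have finE: "finite E" if "tree_graph ?W E" for E
    using that simple_graph_finite by (auto simp: tree_graph_def)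
  have "leaf_trees (insert x ?W) (insert x L) = ?g ` (V \<times> leaf_trees ?W L)"
  proof (intro equalityI subsetI)
    fix E assume "E \<in> leaf_trees (insert x ?W) (insert x L)"
    then have t: "tree_graph (insert x ?W) E" and l: "\<And>v. v \<in> insert x L \<Longrightarrow> degree E v = 1"
      by (auto simp: leaf_trees_def)
    obtain w E' where
      *: "w \<in> ?W" "E = insert {x, w} E'" "tree_graph ?W E'" "{x, w} \<notin> E'" "finite E'"
      by (rule tree_leaf_decomposition[OF t l[OF insertI1], unfolded W]) (rule that; assumption)
    \<comment> \<open>The leaf \<open>x\<close> hangs off a vertex of \<open>V\<close>, as two adjacent leaves would be a component.\<close>
    have "w \<notin> L"
    proof
      assume w: "w \<in> L"
      obtain v where "v \<in> V" using insert.prems by auto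
      then have "v \<noteq> w" "{v, w} \<subseteq> ?W" using w insert.prems by auto
      then have "card ?W \<ge> 2" using insert.hyps insert.prems card_mono[of ?W "{v, w}"] by simp
      then have "degree E' w \<ge> 1" using tree_degree_pos[OF *(3) _ *(1)] by simp
      then show False using degree_insert_edge[OF *(5,4), of w] l[of w] * w by simp
    qed
    moreover have "degree E' v = 1" if "v \<in> L" for v
      using l[of v] degree_insert_edge[OF *(5,4), of v] that \<open>w \<notin> L\<close> x *
      by (auto split: if_splits)
    ultimately show "E \<in> ?g ` (V \<times> leaf_trees ?W L)"
      using * by (auto simp: leaf_trees_def image_iff)
  next
    fix E assume "E \<in> ?g ` (V \<times> leaf_trees ?W L)"
    then obtain w E' where *: "w \<in> V" "E = insert {x, w} E'" "tree_graph ?W E'"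
      "\<And>v. v \<in> L \<Longrightarrow> degree E' v = 1"
      by (auto simp: leaf_trees_def)
    have n: "{x, w} \<notin> E'" using fresh *(3) x by blast
    have "{e \<in> E'. x \<in> e} = {}" using fresh *(3) x by blast
    then have "degree E' x = 0" by (simp only: degree_def card.empty)
    moreover have "w \<notin> L" using * insert.prems by auto
    ultimately have "degree E v = 1" if "v \<in> insert x L" for v
      using degree_insert_edge[OF finE[OF *(3)] n, of v] * that x by auto
    moreover have "tree_graph (insert x ?W) E"
      using tree_insert_leaf[of ?W E' x w] * x by (auto simp: tree_graph_def)
    ultimately show "E \<in> leaf_trees (insert x ?W) (insert x L)" by (simp add: leaf_trees_def)
  qed
  moreover have "inj_on ?g (V \<times> leaf_trees ?W L)"
  proof (rule inj_onI, clarify)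
    fix w E w' E' assume m: "w \<in> V" "w' \<in> V" "E \<in> leaf_trees ?W L" "E' \<in> leaf_trees ?W L"
      and eq: "insert {x, w} E = insert {x, w'} E'"
    have n: "x \<notin> e" if "e \<in> E \<or> e \<in> E'" for e
      using that fresh m x unfolding leaf_trees_def by blast
    then have "{e \<in> insert {x, w} E. x \<in> e} = {{x, w}}" "{e \<in> insert {x, w'} E'. x \<in> e} = {{x, w'}}"
      by auto
    then have "w = w'" using eq by (metis doubleton_eq_iff singleton_inject)
    moreover have "E = E'" using eq n by (metis \<open>w = w'\<close> insertI1 insert_ident)
    ultimately show "w = w' \<and> E = E'" by simp
  qed
  ultimately have "card (leaf_trees (insert x ?W) (insert x L)) = card V * card (leaf_trees ?W L)"
    by (simp add: card_image card_cartesian_product)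
  then show ?case using insert by simp
qed

text \<open>
  The exponent is truncated at zero, which gives the correct value \<open>1\<close> for a single vertex. The
  comparison with words starts at three vertices: a single vertex is not a leaf, and the two vertices
  of an edge are adjacent leaves.
\<close>
theorem cayley:
  assumes "finite V" "V \<noteq> {}"
  shows "card (trees V) = card V ^ (card V - 2)"
  using assms
proof (induction "card V" arbitrary: V rule: less_induct)
  case less
  let ?n = "card V"
  consider "?n = 1" | "?n = 2" | "?n \<ge> 3"
    using less.prems card_gt_0_iff[of V] by linarith
  then show ?case
  proof cases
    case 1
    then obtain v where "V = {v}" by (auto simp: card_1_singleton_iff)
    then show ?thesis by (simp add: trees_def tree_graph_singleton_iff)
  next
    case 2
    then obtain v w where V: "V = {v, w}" "v \<noteq> w" by (auto simp: card_2_iff)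
    have "E = {V}" if t: "tree_graph V E" for E
    proof -
      obtain x where "degree E x = 1" using tree_has_leaf[OF t] 2 by auto
      from tree_leaf_decomposition[OF t this] obtain y E'
        where *: "x \<in> V" "y \<in> V - {x}" "E = insert {x, y} E'" "tree_graph (V - {x}) E'" by blast
      then have "V - {x} = {y}" "V = {x, y}" using V by auto
      then show ?thesis using * by (simp add: tree_graph_singleton_iff)
    qed
    moreover have "tree_graph V {V}"
      using tree_insert_leaf[of "{w}" "{}" v w] V
      by (simp add: tree_graph_singleton_iff simple_graph_def)
    ultimately have "trees V = {{V}}" unfolding trees_def by blast
    then show ?thesis using 2 by simp
  next
    case 3
    let ?A = "\<lambda>v. leaf_trees V {v}" and ?B = "\<lambda>v. {..<?n - 2} \<rightarrow>\<^sub>E V - {v}"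
    have "card (\<Union>(?A ` V)) = card (\<Union>(?B ` V))"
    proof (rule card_Union_eq_if_card_Inter_eq)
      fix J assume J: "J \<subseteq> V" "J \<noteq> {}"
      then have fJ: "finite J" using less.prems finite_subset by blast
      have J0: "card J \<noteq> 0" using fJ J by simp
      let ?c = "card (V - J)"
      have c: "?c + card J = ?n" using J less.prems fJ
        by (simp add: card_Diff_subset card_mono)
      have "\<Inter>(?A ` J) = leaf_trees V J" using J by (auto simp: leaf_trees_def)
      moreover have "card (leaf_trees V J) = ?c ^ (?n - 2)"
      proof (cases "J = V")
        case True
        then show ?thesis using leaf_trees_all_leaves[OF 3] 3 by (simp add: power_0_left)
      next
        case False
        then have "V - J \<noteq> {}" using J by auto
        then have "?c \<noteq> 0" using less.prems by simp
        have "card (leaf_trees V J) = ?c ^ card J * card (trees (V - J))"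
          using card_leaf_trees_Un[of J "V - J"] J fJ less.prems \<open>V - J \<noteq> {}\<close>
          by (simp add: Un_absorb2 Diff_Int_distrib2)
        also have "card (trees (V - J)) = ?c ^ (?c - 2)"
          using less.hyps[of "V - J"] c J0 less.prems \<open>V - J \<noteq> {}\<close> by simp
        also have "?c ^ card J * ?c ^ (?c - 2) = ?c ^ (?n - 2)"
        proof (cases "?c = 1")
          \<comment> \<open>For \<open>?c = 1\<close> the truncated exponents do not add up, but both sides are \<open>1\<close>.\<close>
          case False
          then have "card J + (?c - 2) = ?n - 2" using c \<open>?c \<noteq> 0\<close> by linarith
          then show ?thesis by (simp flip: power_add)
        qed simp
        finally show ?thesis .
      qed
      moreover have "\<Inter>(?B ` J) = {..<?n - 2} \<rightarrow>\<^sub>E V - J"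
        using J by (fastforce simp: PiE_iff extensional_def)
      ultimately show "card (\<Inter>(?A ` J)) = card (\<Inter>(?B ` J))" by (simp add: card_PiE)
    qed (use less.prems in \<open>auto intro: finite_leaf_trees finite_PiE\<close>)
    moreover have "\<Union>(?A ` V) = trees V"
      using tree_has_leaf 3 by (fastforce simp: leaf_trees_def trees_def)
    \<comment> \<open>A word of length \<open>n - 2\<close> misses at least two of the \<open>n\<close> letters.\<close>
    moreover have "\<Union>(?B ` V) = {..<?n - 2} \<rightarrow>\<^sub>E V"
    proof (intro equalityI subsetI)
      fix f assume f: "f \<in> {..<?n - 2} \<rightarrow>\<^sub>E V"
      have "card (f ` {..<?n - 2}) < ?n"
        using card_image_le[of "{..<?n - 2}" f] 3 by simp
      then obtain v where "v \<in> V" "v \<notin> f ` {..<?n - 2}"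
        by (metis card_mono finite_imageI finite_lessThan not_le subsetI)
      then have "f \<in> ?B v" using f by (auto simp: PiE_iff)
      then show "f \<in> \<Union>(?B ` V)" using \<open>v \<in> V\<close> by blast
    next
      fix f assume "f \<in> \<Union>(?B ` V)"
      then show "f \<in> {..<?n - 2} \<rightarrow>\<^sub>E V" by (auto simp: PiE_iff)
    qed
    ultimately show ?thesis by (simp add: card_PiE)
  qed
qed

section \<open>Gluing trees along a tree\<close>

text \<open>
  A subset of a disjoint union is the same as an independent choice of its parts in the pieces.
\<close>
lemma card_piecewise_families:
  assumes fin: "finite X" and sub: "\<And>x. x \<in> X \<Longrightarrow> \<F> x \<subseteq> Pow (A x)"
    and disj: "\<And>x y. x \<in> X \<Longrightarrow> y \<in> X \<Longrightarrow> x \<noteq> y \<Longrightarrow> A x \<inter> A y = {}"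
  shows "card {U. U \<subseteq> \<Union>(A ` X) \<and> (\<forall>x\<in>X. U \<inter> A x \<in> \<F> x)} = (\<Prod>x\<in>X. card (\<F> x))"
    (is "card ?S = _")
proof -
  have cut: "(\<Union>y\<in>X. f y) \<inter> A x = f x" if "f \<in> Pi\<^sub>E X \<F>" "x \<in> X" for f x
  proof -
    have "f y \<subseteq> A y" if "y \<in> X" for y using sub that \<open>f \<in> Pi\<^sub>E X \<F>\<close> by blast
    then show ?thesis using disj \<open>x \<in> X\<close> by blast
  qed
  have "bij_betw (\<lambda>U. \<lambda>x\<in>X. U \<inter> A x) ?S (Pi\<^sub>E X \<F>)"
  proof (rule bij_betw_byWitness[where f' = "\<lambda>f. \<Union>x\<in>X. f x"])
    show "\<forall>U\<in>?S. (\<Union>x\<in>X. (\<lambda>x\<in>X. U \<inter> A x) x) = U" by auto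
    show "\<forall>f\<in>Pi\<^sub>E X \<F>. (\<lambda>x\<in>X. (\<Union>y\<in>X. f y) \<inter> A x) = f"
      using cut by (auto simp: PiE_iff extensional_def fun_eq_iff)
    show "(\<lambda>U. \<lambda>x\<in>X. U \<inter> A x) ` ?S \<subseteq> Pi\<^sub>E X \<F>" by auto
    show "(\<lambda>f. \<Union>x\<in>X. f x) ` Pi\<^sub>E X \<F> \<subseteq> ?S"
    proof safe
      fix f x assume f: "f \<in> Pi\<^sub>E X \<F>" and x: "x \<in> X"
      show "(\<Union>y\<in>X. f y) \<inter> A x \<in> \<F> x" using cut[OF f x] f x by auto
      fix e assume "e \<in> f x"
      then show "e \<in> \<Union>(A ` X)" using sub[OF x] f x by blast
    qed
  qed
  then show ?thesis using fin by (simp add: bij_betw_same_card card_PiE)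
qed

text \<open>
  Pairs of vertices are sorted by their image under \<open>p\<close>. Using the image set as the index treats the two
  kinds of edges alike: \<open>x = {i}\<close> gives the pairs inside the fiber over \<open>i\<close>, and \<open>x = {i, j}\<close> the pairs
  joining two fibers.
\<close>
definition edges_over :: "('a \<Rightarrow> 'b) \<Rightarrow> 'a set \<Rightarrow> 'b set \<Rightarrow> 'a set set" where
  "edges_over p V x = {d. d \<subseteq> V \<and> card d = 2 \<and> p ` d = x}"

lemma edges_over_pair:
  assumes "i \<noteq> j"
  shows "edges_over p V {i, j} = (\<lambda>(u, v). {u, v}) ` ({v \<in> V. p v = i} \<times> {v \<in> V. p v = j})"
proof (intro equalityI subsetI)
  fix d assume "d \<in> edges_over p V {i, j}"
  then have d: "d \<subseteq> V" "card d = 2" "p ` d = {i, j}" by (auto simp: edges_over_def)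
  then obtain u where u: "u \<in> d" "p u = i" by (metis imageE insertI1)
  from d(2) u(1) obtain v where v: "d = {u, v}" by (rule edge_other_end)
  then have "p v = j" using d(3) u(2) assms by (auto simp: doubleton_eq_iff)
  then show "d \<in> (\<lambda>(u, v). {u, v}) ` ({v \<in> V. p v = i} \<times> {v \<in> V. p v = j})"
    using d u v by auto
qed (use assms in \<open>auto simp: edges_over_def card_insert_if\<close>)

lemma card_edges_over_pair:
  assumes "i \<noteq> j"
  shows "card (edges_over p V {i, j}) = card {v \<in> V. p v = i} * card {v \<in> V. p v = j}"
proof -
  have "inj_on (\<lambda>(u, v). {u, v}) ({v \<in> V. p v = i} \<times> {v \<in> V. p v = j})"
    using assms by (auto simp: inj_on_def doubleton_eq_iff)
  then show ?thesis
    by (simp add: edges_over_pair[OF assms] card_image card_cartesian_product)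
qed

lemma edges_over_singleton: "edges_over p V {i} = {d. d \<subseteq> {v \<in> V. p v = i} \<and> card d = 2}"
proof -
  have "p ` d = {i} \<longleftrightarrow> d \<subseteq> {v. p v = i}" if "card d = 2" for d
    using that by (auto simp: card_2_iff)
  then show ?thesis unfolding edges_over_def by auto
qed

text \<open>Each vertex \<open>i\<close> contributes one factor \<open>b i\<close> for each edge at \<open>i\<close>.\<close>
lemma prod_edges_eq_prod_degree:
  fixes b :: "'a \<Rightarrow> 'b::comm_monoid_mult"
  assumes "simple_graph I T"
  shows "(\<Prod>e\<in>T. \<Prod>i\<in>e. b i) = (\<Prod>i\<in>I. b i ^ degree T i)"
proof -
  have fin: "finite I" "finite T" using simple_graph_finite[OF assms] by auto
  have "(\<Prod>e\<in>T. \<Prod>i\<in>e. b i) = (\<Prod>e\<in>T. \<Prod>i\<in>{i \<in> I. i \<in> e}. b i)"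
    using assms by (intro prod.cong) (auto simp: simple_graph_def)
  also have "\<dots> = (\<Prod>i\<in>I. \<Prod>e\<in>{e \<in> T. i \<in> e}. b i)"
    using prod.swap_restrict[OF fin(2,1), of "\<lambda>e i. b i" "\<lambda>e i. i \<in> e"] by simp
  finally show ?thesis by (simp add: degree_def)
qed

text \<open>
  The trees on \<open>V\<close> in which the fibers of \<open>p\<close> are subtrees whose contraction is \<open>T\<close>. Images of edges
  inside a fiber are singletons, so the condition on the cardinality drops the loops.
\<close>
definition glued_trees :: "('a \<Rightarrow> 'b) \<Rightarrow> 'a set \<Rightarrow> 'b set \<Rightarrow> 'b set set \<Rightarrow> 'a set set set" where
  "glued_trees p V I T = {U. tree_graph V U \<and>
     (\<forall>i\<in>I. tree_graph {v \<in> V. p v = i} (induced_edges U {v \<in> V. p v = i})) \<and>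
     {e \<in> image p ` U. card e = 2} = T}"

lemma simple_graph_subset: "simple_graph V E \<longleftrightarrow> finite V \<and> E \<subseteq> {d. d \<subseteq> V \<and> card d = 2}"
  by (auto simp: simple_graph_def)

lemma induced_edges_fiber:
  assumes "simple_graph V U"
  shows "induced_edges U {v \<in> V. p v = i} = U \<inter> edges_over p V {i}"
  using assms by (auto simp: induced_edges_def edges_over_singleton simple_graph_def)

text \<open>
  In both directions the edges within the fibers number \<open>card V - card I\<close>. Hence \<open>U\<close> has
  \<open>card V - 1\<close> edges iff exactly \<open>card I - 1 = card T\<close> edges lie over \<open>T\<close>. If \<open>U\<close> is a tree contracting
  to \<open>T\<close>, each edge of \<open>T\<close> has at least one edge over it, so it has exactly one. Conversely one
  edge over each edge of \<open>T\<close> gives the edge count of a tree, and walks in \<open>T\<close> lift to \<open>U\<close> through the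
  connected fibers.
\<close>
lemma glued_trees_piecewise:
  fixes p :: "'a \<Rightarrow> 'b"
  assumes fin: "finite V" and surj: "p ` V = I" and T: "tree_graph I T"
  defines "F \<equiv> \<lambda>i. {v \<in> V. p v = i}" and "A \<equiv> edges_over p V"
  shows "U \<in> glued_trees p V I T \<longleftrightarrow>
     U \<subseteq> (\<Union>x\<in>(\<lambda>i. {i}) ` I \<union> T. A x) \<and>
     (\<forall>i\<in>I. U \<inter> A {i} \<in> trees (F i)) \<and> (\<forall>e\<in>T. card (U \<inter> A e) = 1)"
    (is "?L \<longleftrightarrow> ?R")
proof -
  have finI: "finite I" using fin surj by auto
  have T2: "e \<subseteq> I" "card e = 2" if "e \<in> T" for e
    using T that by (auto simp: tree_graph_def simple_graph_def)
  have finT: "finite T" using T simple_graph_finite by (auto simp: tree_graph_def)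
  have cardT: "Suc (card T) = card I"
    using T tree_iff_connected_card by (metis tree_graph_def)
  have nosing: "{i} \<notin> T" for i using T2[of "{i}"] by auto
  have Fne: "F i \<noteq> {}" if "i \<in> I" for i using that surj by (auto simp: F_def)
  have finA: "finite (A x)" for x
    by (rule finite_subset[of _ "Pow V"]) (use fin in \<open>auto simp: A_def edges_over_def\<close>)
  have disjA: "A x \<inter> A y = {}" if "x \<noteq> y" for x y
    using that by (auto simp: A_def edges_over_def)
  have sumF: "(\<Sum>i\<in>I. card (F i)) = card V"
  proof -
    have "V = (\<Union>i\<in>I. F i)" using surj by (auto simp: F_def)
    moreover have "card (\<Union>i\<in>I. F i) = (\<Sum>i\<in>I. card (F i))"
      using finI fin by (intro card_UN_disjoint) (auto simp: F_def)
    ultimately show ?thesis by simp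
  qed
  have simp_F: "simple_graph (F i) (U \<inter> A {i})" for i
    using fin by (auto simp: simple_graph_subset F_def A_def edges_over_singleton)
  \<comment> \<open>A fiber of size \<open>b\<close> contains \<open>b - 1\<close> edges; the term \<open>card I\<close> avoids the subtraction.\<close>
  have count: "card U + card I = card V + (\<Sum>e\<in>T. card (U \<inter> A e))"
    if sub: "U \<subseteq> (\<Union>x\<in>(\<lambda>i. {i}) ` I \<union> T. A x)" and tr: "\<forall>i\<in>I. U \<inter> A {i} \<in> trees (F i)"
  proof -
    have "card U = card (\<Union>x\<in>(\<lambda>i. {i}) ` I \<union> T. U \<inter> A x)"
      using sub by (intro arg_cong[of _ _ card]) auto
    also have "\<dots> = (\<Sum>x\<in>(\<lambda>i. {i}) ` I \<union> T. card (U \<inter> A x))"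
    proof (rule card_UN_disjoint)
      show "finite ((\<lambda>i. {i}) ` I \<union> T)" using finI finT by simp
      show "\<forall>x\<in>(\<lambda>i. {i}) ` I \<union> T. finite (U \<inter> A x)" using finA by simp
      show "\<forall>x\<in>(\<lambda>i. {i}) ` I \<union> T. \<forall>y\<in>(\<lambda>i. {i}) ` I \<union> T. x \<noteq> y \<longrightarrow>
          (U \<inter> A x) \<inter> (U \<inter> A y) = {}"
      proof (intro ballI impI)
        fix x y :: "'b set" assume "x \<noteq> y"
        then have "A x \<inter> A y = {}" by (rule disjA)
        then show "(U \<inter> A x) \<inter> (U \<inter> A y) = {}" by blast
      qed
    qed
    also have "\<dots> = (\<Sum>i\<in>I. card (U \<inter> A {i})) + (\<Sum>e\<in>T. card (U \<inter> A e))"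
      using finI finT nosing by (subst sum.union_disjoint) (auto simp: sum.reindex)
    finally have "card U + card I = (\<Sum>i\<in>I. Suc (card (U \<inter> A {i}))) + (\<Sum>e\<in>T. card (U \<inter> A e))"
      by (simp add: sum_Suc)
    also have "(\<Sum>i\<in>I. Suc (card (U \<inter> A {i}))) = (\<Sum>i\<in>I. card (F i))"
      using tr tree_iff_connected_card[OF simp_F] by (intro sum.cong) (auto simp: trees_def)
    finally show ?thesis using sumF by simp
  qed
  show ?thesis
  proof
    assume L: ?L
    then have U: "tree_graph V U" "simple_graph V U" and q: "{e \<in> image p ` U. card e = 2} = T"
      by (auto simp: glued_trees_def tree_graph_def)
    have tr: "\<forall>i\<in>I. U \<inter> A {i} \<in> trees (F i)"
      using L induced_edges_fiber[OF U(2), of p] by (simp add: glued_trees_def trees_def F_def A_def)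
    have sub: "U \<subseteq> (\<Union>x\<in>(\<lambda>i. {i}) ` I \<union> T. A x)"
    proof
      fix d assume d: "d \<in> U"
      then have d2: "d \<subseteq> V" "card d = 2" using U by (auto simp: simple_graph_def)
      then obtain u v where uv: "d = {u, v}" by (auto simp: card_2_iff)
      have "p ` d \<in> (\<lambda>i. {i}) ` I \<union> T"
      proof (cases "p u = p v")
        case True
        then show ?thesis using uv d2 surj by auto
      next
        case False
        then have "card (p ` d) = 2" using uv by simp
        then show ?thesis using q d by blast
      qed
      then show "d \<in> (\<Union>x\<in>(\<lambda>i. {i}) ` I \<union> T. A x)"
        using d2 by (auto simp: A_def edges_over_def)
    qed
    have pos: "1 \<le> card (U \<inter> A e)" if "e \<in> T" for e
    proof -
      from that q obtain d where "d \<in> U" "p ` d = e" by blast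
      then have "d \<in> U \<inter> A e" using U(2) by (auto simp: A_def edges_over_def simple_graph_def)
      then show ?thesis using finA[of e] by (simp add: Suc_le_eq card_gt_0_iff) blast
    qed
    have "(\<Sum>e\<in>T. card (U \<inter> A e)) = (\<Sum>e\<in>T. 1)"
      using count[OF sub tr] cardT tree_iff_connected_card[OF U(2)] U(1) by simp
    then have "\<forall>e\<in>T. card (U \<inter> A e) = 1"
      using sum_mono_inv[of "\<lambda>_. 1" T "\<lambda>e. card (U \<inter> A e)"] pos finT by metis
    with sub tr show ?R by blast
  next
    assume R: ?R
    then have sub: "U \<subseteq> (\<Union>x\<in>(\<lambda>i. {i}) ` I \<union> T. A x)"
      and tr: "\<forall>i\<in>I. U \<inter> A {i} \<in> trees (F i)" and one: "\<forall>e\<in>T. card (U \<inter> A e) = 1" by auto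
    have sU: "simple_graph V U"
      using sub fin by (fastforce simp: simple_graph_subset A_def edges_over_def)
    have same: "(u, v) \<in> (adj U)\<^sup>*" if "u \<in> V" "v \<in> V" "p u = p v" for u v
    proof -
      have "p u \<in> I" using that surj by auto
      then have "(u, v) \<in> (adj (U \<inter> A {p u}))\<^sup>*"
        using tr that by (auto simp: trees_def tree_graph_def connected_graph_def F_def)
      moreover have "adj (U \<inter> A {p u}) \<subseteq> adj U" by auto
      ultimately show ?thesis using rtrancl_mono by blast
    qed
    \<comment> \<open>Lift a walk in \<open>T\<close>, moving inside a fiber to the next connecting edge.\<close>
    have conn: "\<forall>v\<in>F j. (u, v) \<in> (adj U)\<^sup>*" if "(p u, j) \<in> (adj T)\<^sup>*" and u: "u \<in> V" for u j
      using that(1)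
    proof (induction rule: rtrancl_induct)
      case base
      then show ?case using same u by (auto simp: F_def)
    next
      case (step j k)
      then have e: "{j, k} \<in> T" by simp
      then have "j \<noteq> k" using nosing by auto
      obtain d where "d \<in> U" "d \<in> A {j, k}"
        using one e by (metis Int_iff card_1_singletonE singletonI)
      then obtain x y where xy: "{x, y} \<in> U" "x \<in> F j" "y \<in> F k"
        using edges_over_pair[OF \<open>j \<noteq> k\<close>, of p V] by (auto simp: A_def F_def)
      then have "(u, y) \<in> (adj U)\<^sup>*" using step.IH by (auto intro: rtrancl_into_rtrancl)
      then show ?case using same[of y] xy by (auto simp: F_def intro: rtrancl_trans)
    qed
    have "connected_graph V U"
      unfolding connected_graph_def
    proof (intro conjI ballI)
      show "V \<noteq> {}" using T surj by (auto simp: tree_graph_def connected_graph_def)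
      fix u v assume "u \<in> V" "v \<in> V"
      moreover from this have "(p u, p v) \<in> (adj T)\<^sup>*"
        using T surj by (auto simp: tree_graph_def connected_graph_def)
      ultimately show "(u, v) \<in> (adj U)\<^sup>*" using conn[of u "p v"] by (auto simp: F_def)
    qed
    moreover have "Suc (card U) = card V" using count[OF sub tr] one cardT by simp
    ultimately have "tree_graph V U" using tree_iff_connected_card[OF sU] by simp
    moreover have "{e \<in> image p ` U. card e = 2} = T"
    proof (intro equalityI subsetI)
      fix e assume "e \<in> {e \<in> image p ` U. card e = 2}"
      then obtain d where d: "d \<in> U" "e = p ` d" "card e = 2" by auto
      from subsetD[OF sub d(1)] obtain x where x: "x \<in> (\<lambda>i. {i}) ` I \<union> T" "d \<in> A x" by blast
      then have "x = e" using d by (simp add: A_def edges_over_def)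
      then show "e \<in> T" using x d by auto
    next
      fix e assume e: "e \<in> T"
      then obtain d where "d \<in> U" "d \<in> A e"
        using one by (metis Int_iff card_1_singletonE singletonI)
      then show "e \<in> {e \<in> image p ` U. card e = 2}"
        using T2[OF e] by (auto simp: A_def edges_over_def)
    qed
    moreover have "\<forall>i\<in>I. tree_graph (F i) (induced_edges U (F i))"
      using tr induced_edges_fiber[OF sU, of p] by (simp add: trees_def F_def A_def)
    ultimately show ?L unfolding glued_trees_def F_def by blast
  qed
qed

theorem card_glued_trees:
  fixes p :: "'a \<Rightarrow> 'b"
  assumes fin: "finite V" and surj: "p ` V = I" and T: "tree_graph I T"
  defines "b \<equiv> \<lambda>i. card {v \<in> V. p v = i}"
  shows "card (glued_trees p V I T) = (\<Prod>i\<in>I. b i ^ (b i - 2 + degree T i))"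
proof -
  define F where "F = (\<lambda>i. {v \<in> V. p v = i})"
  define A where "A = edges_over p V"
  define X where "X = (\<lambda>i. {i}) ` I \<union> T"
  define \<F> where "\<F> = (\<lambda>x. if x \<in> T then {D. D \<subseteq> A x \<and> card D = 1} else trees (F (the_elem x)))"
  have sT: "simple_graph I T" using T by (simp add: tree_graph_def)
  have finI: "finite I" and finT: "finite T" using simple_graph_finite[OF sT] by auto
  have nosing: "{i} \<notin> T" for i using sT by (auto simp: simple_graph_def)
  have finA: "finite (A x)" for x
    by (rule finite_subset[of _ "Pow V"]) (use fin in \<open>auto simp: A_def edges_over_def\<close>)
  have "glued_trees p V I T = {U. U \<subseteq> \<Union>(A ` X) \<and> (\<forall>x\<in>X. U \<inter> A x \<in> \<F> x)}"
  proof -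
    have "(\<forall>x\<in>X. U \<inter> A x \<in> \<F> x) \<longleftrightarrow>
        (\<forall>i\<in>I. U \<inter> A {i} \<in> trees (F i)) \<and> (\<forall>e\<in>T. card (U \<inter> A e) = 1)" for U
      unfolding X_def ball_Un by (simp add: \<F>_def nosing)
    then have "U \<in> glued_trees p V I T \<longleftrightarrow> U \<subseteq> \<Union>(A ` X) \<and> (\<forall>x\<in>X. U \<inter> A x \<in> \<F> x)" for U
      using glued_trees_piecewise[OF assms(1-3), of U] unfolding X_def A_def F_def by simp
    then show ?thesis by (intro set_eqI) simp
  qed
  also have "card \<dots> = (\<Prod>x\<in>X. card (\<F> x))"
  proof (rule card_piecewise_families)
    show "finite X" using finI finT by (simp add: X_def)
    show "\<F> x \<subseteq> Pow (A x)" if "x \<in> X" for x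
      using that by (auto simp: X_def \<F>_def A_def F_def edges_over_singleton trees_def
          tree_graph_def simple_graph_def)
    show "A x \<inter> A y = {}" if "x \<noteq> y" for x y
      using that by (auto simp: A_def edges_over_def)
  qed
  also have "\<dots> = (\<Prod>i\<in>I. card (\<F> {i})) * (\<Prod>e\<in>T. card (\<F> e))"
    unfolding X_def using finI finT nosing
    by (subst prod.union_disjoint) (auto simp: prod.reindex)
  also have "(\<Prod>i\<in>I. card (\<F> {i})) = (\<Prod>i\<in>I. b i ^ (b i - 2))"
  proof (rule prod.cong)
    fix i assume "i \<in> I"
    then have "F i \<noteq> {}" "finite (F i)" using surj fin by (auto simp: F_def)
    then show "card (\<F> {i}) = b i ^ (b i - 2)"
      using cayley[of "F i"] nosing by (simp add: \<F>_def b_def F_def)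
  qed simp
  also have "(\<Prod>e\<in>T. card (\<F> e)) = (\<Prod>e\<in>T. \<Prod>i\<in>e. b i)"
  proof (rule prod.cong)
    fix e assume e: "e \<in> T"
    then obtain i j where ij: "e = {i, j}" "i \<noteq> j"
      using sT by (auto simp: simple_graph_def card_2_iff)
    have "card (\<F> e) = card (A e)" using e finA by (simp add: \<F>_def n_subsets)
    then show "card (\<F> e) = (\<Prod>i\<in>e. b i)"
      using card_edges_over_pair[OF ij(2), of p V] ij by (simp add: A_def b_def)
  qed simp
  also have "\<dots> = (\<Prod>i\<in>I. b i ^ degree T i)" by (rule prod_edges_eq_prod_degree[OF sT])
  finally show ?thesis by (simp add: power_add prod.distrib)
qed

section \<open>Retractions with given fiber sizes\<close>

text \<open>
  Sorted by the value \<open>i\<close> at a new point, the functions on \<open>insert x X\<close> restrict to functions on \<open>X\<close>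
  whose fiber over \<open>i\<close> is smaller by one. This is the recursion of multinomial coefficients,
  in the form \<open>(N + 1)! = (\<Sum>i. k i) * N!\<close>.
\<close>
lemma card_functions_with_fiber_sizes:
  assumes "finite X" "finite I" "(\<Sum>i\<in>I. k i) = card X"
  shows "real (card {f \<in> X \<rightarrow>\<^sub>E I. \<forall>i\<in>I. card {x \<in> X. f x = i} = k i}) = multinomial (card X) I k"
    (is "real (card (?S X k)) = _")
  using assms(1,3)
proof (induction X arbitrary: k)
  case empty
  then have "\<forall>i\<in>I. k i = 0" using \<open>finite I\<close> by simp
  then show ?case by (simp add: multinomial_def)
next
  case (insert x X)
  let ?N = "card X" and ?P = "\<Prod>i\<in>I. fact (k i) :: real"
  let ?T = "\<lambda>i. {f \<in> ?S (insert x X) k. f x = i}"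
  have finS: "finite (?S (insert x X) k)"
    by (rule finite_subset[OF _ finite_PiE[of "insert x X" "\<lambda>_. I"]])
       (use insert.hyps \<open>finite I\<close> in auto)
  have fiber: "card {y \<in> insert x X. (g(x := i)) y = j} =
      (if j = i then Suc (card {y \<in> X. g y = j}) else card {y \<in> X. g y = j})" for g i j
  proof -
    have "{y \<in> insert x X. (g(x := i)) y = j} =
        (if j = i then insert x {y \<in> X. g y = j} else {y \<in> X. g y = j})"
      using insert.hyps by auto
    then show ?thesis using insert.hyps by simp
  qed
  have part: "real (card (?T i)) = k i * (fact ?N / ?P)" if i: "i \<in> I" for i
  proof (cases "k i")
    case 0
    have "card {y \<in> insert x X. f y = i} \<noteq> 0" if "f x = i" for f
      using that insert.hyps by auto
    moreover have "card {y \<in> insert x X. f y = i} = 0" if "f \<in> ?T i" for f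
      using that i 0 by auto
    ultimately have "?T i = {}" by blast
    then show ?thesis using 0 by (simp only: card.empty)
  next
    case (Suc l)
    let ?k = "k(i := l)"
    have "bij_betw (\<lambda>g. g(x := i)) (?S X ?k) (?T i)"
    proof (rule bij_betw_byWitness[where f' = "\<lambda>f. f(x := undefined)"])
      show "\<forall>g\<in>?S X ?k. (g(x := i))(x := undefined) = g"
        using insert.hyps by (auto simp: PiE_iff extensional_def fun_eq_iff)
      show "\<forall>f\<in>?T i. (f(x := undefined))(x := i) = f" by auto
      show "(\<lambda>g. g(x := i)) ` ?S X ?k \<subseteq> ?T i"
      proof (rule image_subsetI)
        fix g assume g: "g \<in> ?S X ?k"
        have "g(x := i) \<in> insert x X \<rightarrow>\<^sub>E I" using g i by (intro PiE_fun_upd) auto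
        moreover have "card {y \<in> insert x X. (g(x := i)) y = j} = k j" if "j \<in> I" for j
          unfolding fiber using g i that Suc by simp
        ultimately show "g(x := i) \<in> ?T i" by (simp del: fun_upd_apply add: fun_upd_same)
      qed
      show "(\<lambda>f. f(x := undefined)) ` ?T i \<subseteq> ?S X ?k"
      proof (rule image_subsetI)
        fix f assume "f \<in> ?T i"
        then have f: "f \<in> insert x X \<rightarrow>\<^sub>E I" "f(x := i) = f"
          "\<And>j. j \<in> I \<Longrightarrow> card {y \<in> insert x X. f y = j} = k j" by auto
        have "f(x := undefined) \<in> X \<rightarrow>\<^sub>E I" using f(1) insert.hyps by (simp add: fun_upd_in_PiE)
        moreover have "card {y \<in> X. (f(x := undefined)) y = j} = ?k j" if "j \<in> I" for j
        proof -
          have "{y \<in> X. (f(x := undefined)) y = j} = {y \<in> X. f y = j}"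
            using insert.hyps by auto
          then show ?thesis
            using fiber[of f i j] f(3)[OF that] Suc unfolding f(2) by (simp split: if_splits)
        qed
        ultimately show "f(x := undefined) \<in> ?S X ?k" by (simp del: fun_upd_apply)
      qed
    qed
    then have "card (?T i) = card (?S X ?k)" by (rule bij_betw_same_card[symmetric])
    moreover have "sum ?k I = ?N"
      using insert.prems insert.hyps i Suc \<open>finite I\<close>
      by (simp add: sum.remove[of I i])
    then have "real (card (?S X ?k)) = fact ?N / (\<Prod>j\<in>I. fact (?k j))"
      using insert.IH[of ?k] by (simp add: multinomial_def)
    moreover have "?P = real (k i) * (\<Prod>j\<in>I. fact (?k j))"
      using i Suc \<open>finite I\<close> by (simp add: prod.remove[of I i] algebra_simps)
    ultimately show ?thesis using Suc by simp
  qed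
  have "?S (insert x X) k = (\<Union>i\<in>I. ?T i)" by auto
  then have "card (?S (insert x X) k) = card (\<Union>i\<in>I. ?T i)" by (rule arg_cong)
  also have "\<dots> = (\<Sum>i\<in>I. card (?T i))"
  proof (rule card_UN_disjoint)
    show "\<forall>i\<in>I. finite (?T i)"
      by (intro ballI finite_subset[OF _ finS]) auto
  qed (use \<open>finite I\<close> in auto)
  finally have "real (card (?S (insert x X) k)) = (\<Sum>i\<in>I. k i * (fact ?N / ?P))"
    using part by simp
  also have "\<dots> = real (\<Sum>i\<in>I. k i) * (fact ?N / ?P)"
    by (simp add: sum_distrib_right sum_divide_distrib)
  finally show ?case using insert.prems insert.hyps by (simp add: multinomial_def)
qed

text \<open>The labels start at \<open>1\<close> and list positions at \<open>0\<close>.\<close>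
lemma bij_betw_nth_element:
  assumes "finite R"
  shows "bij_betw (nth_element R) {1..card R} R"
proof -
  have "bij_betw (\<lambda>i. i - 1) {1..card R} {..<card R}"
    by (rule bij_betw_byWitness[where f' = Suc]) auto
  moreover have "bij_betw ((!) (sorted_list_of_set R)) {..<card R} R"
    using assms by (intro bij_betw_nth) auto
  ultimately show ?thesis
    using bij_betw_trans unfolding nth_element_def comp_def by blast
qed

definition retractions :: "'a set \<Rightarrow> 'a set \<Rightarrow> ('a \<Rightarrow> 'a) set" where
  "retractions V R = {q \<in> V \<rightarrow>\<^sub>E R. \<forall>r\<in>R. q r = r}"

lemma finite_retractions: "finite V \<Longrightarrow> finite R \<Longrightarrow> finite (retractions V R)"
  unfolding retractions_def by (auto intro: finite_subset[OF _ finite_PiE[of V "\<lambda>_. R"]])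

text \<open>
  A retraction onto \<open>R\<close> is determined by its values off \<open>R\<close>, which are arbitrary; the fiber over an
  element of \<open>R\<close> contains this element in addition to those mapped to it from outside.
\<close>
lemma card_retractions_with_fiber_sizes:
  assumes R: "R \<subseteq> {1..m}" "card R = n" and b: "b \<in> compositions m n"
  shows "real (card {q \<in> retractions {1..m} R. \<forall>i\<in>{1..n}. card (fiber m q (nth_element R i)) = b i})
    = multinomial (m - n) {1..n} (\<lambda>i. b i - 1)"
proof -
  let ?\<sigma> = "nth_element R" and ?X = "{1..m} - R" and ?I = "{1..n}"
  let ?\<tau> = "inv_into ?I ?\<sigma>"
  let ?Q = "{q \<in> retractions {1..m} R. \<forall>i\<in>?I. card (fiber m q (?\<sigma> i)) = b i}"
  let ?S = "{f \<in> ?X \<rightarrow>\<^sub>E ?I. \<forall>i\<in>?I. card {x \<in> ?X. f x = i} = b i - 1}"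
  have fin: "finite R" using R finite_subset by blast
  then have bij: "bij_betw ?\<sigma> ?I R" using bij_betw_nth_element R by blast
  have \<sigma>: "?\<sigma> i \<in> R" "?\<tau> (?\<sigma> i) = i" if "i \<in> ?I" for i
    using bij that by (auto simp: bij_betw_def)
  have \<tau>: "?\<tau> r \<in> ?I" "?\<sigma> (?\<tau> r) = r" if "r \<in> R" for r
    using bij that by (metis bij_betw_def inv_into_into, metis bij_betw_def f_inv_into_f)
  have b1: "b i \<ge> 1" if "i \<in> ?I" for i using b that by (auto simp: compositions_def)
  have fiber: "card (fiber m q (?\<sigma> i)) = Suc (card {x \<in> ?X. ?\<tau> (q x) = i})"
    if q: "q \<in> retractions {1..m} R" and i: "i \<in> ?I" for q i
  proof -
    have "fiber m q (?\<sigma> i) = insert (?\<sigma> i) {x \<in> ?X. ?\<tau> (q x) = i}"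
    proof (intro equalityI subsetI)
      fix x assume "x \<in> fiber m q (?\<sigma> i)"
      then show "x \<in> insert (?\<sigma> i) {x \<in> ?X. ?\<tau> (q x) = i}"
        using q \<sigma>(2)[OF i] by (cases "x \<in> R") (auto simp: fiber_def retractions_def)
    next
      fix x assume x: "x \<in> insert (?\<sigma> i) {x \<in> ?X. ?\<tau> (q x) = i}"
      show "x \<in> fiber m q (?\<sigma> i)"
      proof (cases "x = ?\<sigma> i")
        case True
        then show ?thesis using q \<sigma>(1)[OF i] R by (auto simp: fiber_def retractions_def)
      next
        case False
        then have "q x \<in> R" "x \<in> {1..m}" "?\<tau> (q x) = i" using x q by (auto simp: retractions_def)
        then show ?thesis using \<tau>(2) by (auto simp: fiber_def)
      qed
    qed
    then show ?thesis using \<sigma>(1)[OF i] by simp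
  qed
  have "bij_betw (\<lambda>q. \<lambda>x\<in>?X. ?\<tau> (q x)) ?Q ?S"
  proof (rule bij_betw_byWitness[where f' = "\<lambda>f. \<lambda>x\<in>{1..m}. if x \<in> R then x else ?\<sigma> (f x)"])
    let ?g = "\<lambda>f. \<lambda>x\<in>{1..m}. if x \<in> R then x else ?\<sigma> (f x)"
    show "\<forall>q\<in>?Q. ?g (\<lambda>x\<in>?X. ?\<tau> (q x)) = q"
    proof
      fix q assume "q \<in> ?Q"
      then have q: "q \<in> {1..m} \<rightarrow>\<^sub>E R" "\<forall>r\<in>R. q r = r" by (auto simp: retractions_def)
      show "?g (\<lambda>x\<in>?X. ?\<tau> (q x)) = q"
        using q \<tau>(2) by (auto simp: fun_eq_iff PiE_iff extensional_def restrict_def)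
    qed
    show "\<forall>f\<in>?S. (\<lambda>x\<in>?X. ?\<tau> (?g f x)) = f"
      using \<sigma>(2) by (auto simp: fun_eq_iff PiE_iff extensional_def restrict_def)
    show "(\<lambda>q. \<lambda>x\<in>?X. ?\<tau> (q x)) ` ?Q \<subseteq> ?S"
    proof (rule image_subsetI)
      fix q assume q: "q \<in> ?Q"
      then have qR: "q x \<in> R" if "x \<in> {1..m}" for x using that by (auto simp: retractions_def)
      have "card {x \<in> ?X. (\<lambda>x\<in>?X. ?\<tau> (q x)) x = i} = b i - 1" if "i \<in> ?I" for i
      proof -
        have "{x \<in> ?X. (\<lambda>x\<in>?X. ?\<tau> (q x)) x = i} = {x \<in> ?X. ?\<tau> (q x) = i}" by auto
        then show ?thesis using fiber[of q i] q that by simp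
      qed
      then show "(\<lambda>x\<in>?X. ?\<tau> (q x)) \<in> ?S" using \<tau>(1) qR by auto
    qed
    show "?g ` ?S \<subseteq> ?Q"
    proof (rule image_subsetI)
      fix f assume f: "f \<in> ?S"
      then have fI: "f x \<in> ?I" if "x \<in> ?X" for x using that by auto
      have q: "?g f \<in> retractions {1..m} R"
        using \<sigma>(1) fI R by (auto simp: retractions_def)
      have "card (fiber m (?g f) (?\<sigma> i)) = b i" if "i \<in> ?I" for i
      proof -
        have "{x \<in> ?X. ?\<tau> (?g f x) = i} = {x \<in> ?X. f x = i}"
          using \<sigma>(2)[OF fI] by auto
        then show ?thesis using fiber[OF q that] f b1[OF that] that by simp
      qed
      then show "?g f \<in> ?Q" using q by simp
    qed
  qed
  then have "card ?Q = card ?S" by (rule bij_betw_same_card)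
  moreover have cX: "card ?X = m - n" using R fin by (simp add: card_Diff_subset)
  have "(\<Sum>i\<in>?I. b i - 1) = (\<Sum>i\<in>?I. b i) - (\<Sum>i\<in>?I. 1)"
    by (rule sum_subtractf_nat) (use b1 in auto)
  then have "(\<Sum>i\<in>?I. b i - 1) = card ?X"
    using b unfolding cX by (simp add: compositions_def)
  from card_functions_with_fiber_sizes[OF _ _ this] cX
  have "real (card ?S) = multinomial (m - n) ?I (\<lambda>i. b i - 1)" by simp
  ultimately show ?thesis by simp
qed

lemma sum_retractions_by_fiber_sizes:
  fixes h :: "(nat \<Rightarrow> nat) \<Rightarrow> real"
  assumes R: "R \<subseteq> {1..m}" "card R = n"
  shows "(\<Sum>q\<in>retractions {1..m} R. h (\<lambda>i\<in>{1..n}. card (fiber m q (nth_element R i)))) =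
    (\<Sum>b\<in>compositions m n. multinomial (m - n) {1..n} (\<lambda>i. b i - 1) * h b)"
proof -
  let ?Q = "retractions {1..m} R" and ?g = "\<lambda>q. \<lambda>i\<in>{1..n}. card (fiber m q (nth_element R i))"
  have fin: "finite R" using R finite_subset by blast
  then have bij: "bij_betw (nth_element R) {1..n} R" using bij_betw_nth_element R by blast
  have sub: "?g ` ?Q \<subseteq> compositions m n"
  proof (rule image_subsetI)
    fix q assume q: "q \<in> ?Q"
    have "card (fiber m q r) \<ge> 1" if "r \<in> R" for r
    proof -
      have "r \<in> fiber m q r" using that q R by (auto simp: fiber_def retractions_def)
      moreover have "finite (fiber m q r)" by (simp add: fiber_def)
      ultimately show ?thesis by (metis One_nat_def Suc_leI card_gt_0_iff empty_iff)
    qed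
    then have "\<forall>i\<in>{1..n}. card (fiber m q (nth_element R i)) \<ge> 1"
      using bij by (auto simp: bij_betw_def)
    moreover have "(\<Sum>i=1..n. card (fiber m q (nth_element R i))) = m"
    proof -
      have "(\<Sum>i=1..n. card (fiber m q (nth_element R i))) = (\<Sum>r\<in>R. card (fiber m q r))"
        using sum.reindex_bij_betw[OF bij] .
      also have "\<dots> = card (\<Union>r\<in>R. fiber m q r)"
        using fin by (intro card_UN_disjoint[symmetric]) (auto simp: fiber_def)
      also have "(\<Union>r\<in>R. fiber m q r) = {1..m}"
        using q by (auto simp: fiber_def retractions_def)
      finally show ?thesis by simp
    qed
    ultimately show "?g q \<in> compositions m n" by (simp add: compositions_def)
  qed
  have "(\<Sum>q\<in>?Q. h (?g q)) = (\<Sum>b\<in>compositions m n. \<Sum>q\<in>{q \<in> ?Q. ?g q = b}. h (?g q))"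
    by (rule sum.group[symmetric, OF finite_retractions finite_compositions sub])
       (use fin in auto)
  also have "\<dots> = (\<Sum>b\<in>compositions m n. real (card {q \<in> ?Q. ?g q = b}) * h b)"
    by simp
  also have "\<dots> = (\<Sum>b\<in>compositions m n. multinomial (m - n) {1..n} (\<lambda>i. b i - 1) * h b)"
  proof (rule sum.cong)
    fix b assume b: "b \<in> compositions m n"
    then have "?g q = b \<longleftrightarrow> (\<forall>i\<in>{1..n}. card (fiber m q (nth_element R i)) = b i)" for q
      by (auto simp: compositions_def PiE_iff extensional_def fun_eq_iff)
    then show "real (card {q \<in> ?Q. ?g q = b}) * h b =
        multinomial (m - n) {1..n} (\<lambda>i. b i - 1) * h b"
      using card_retractions_with_fiber_sizes[OF R b] by simp
  qed simp
  finally show ?thesis .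
qed

section \<open>Counting displays\<close>

text \<open>
  Relabelling \<open>r\<^sub>i\<close> as \<open>i\<close> turns the retraction \<open>q\<close> into a map \<open>p\<close> onto the vertex set of \<open>T\<close>, whose
  contraction is literally the image of the edge set.
\<close>
lemma displayed_trees_eq_glued_trees:
  fixes m :: nat
  assumes R: "R \<subseteq> {1..m}" "card R = n" and q: "q \<in> retractions {1..m} R"
  defines "p \<equiv> \<lambda>v. inv_into {1..n} (nth_element R) (q v)"
  shows "{U \<in> labeled_trees m. (R, q) \<in> displays n T m U} = glued_trees p {1..m} {1..n} T"
    and "p ` {1..m} = {1..n}"
    and "\<And>i. i \<in> {1..n} \<Longrightarrow> {v \<in> {1..m}. p v = i} = fiber m q (nth_element R i)"
proof -
  have "finite R" using R finite_subset by blast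
  then have bij: "bij_betw (nth_element R) {1..n} R" using bij_betw_nth_element R by blast
  have qR: "q v \<in> R" if "v \<in> {1..m}" for v using q that by (auto simp: retractions_def)
  have p: "p v = i \<longleftrightarrow> q v = nth_element R i" if "v \<in> {1..m}" "i \<in> {1..n}" for v i
    using bij_betw_inv_into_left[OF bij that(2)] bij_betw_inv_into_right[OF bij qR[OF that(1)]]
    unfolding p_def by metis
  have pv: "p v \<in> {1..n}" if "v \<in> {1..m}" for v
    using bij qR[OF that] unfolding p_def bij_betw_def by (metis inv_into_into)
  show fib: "{v \<in> {1..m}. p v = i} = fiber m q (nth_element R i)" if "i \<in> {1..n}" for i
    using p that by (auto simp: fiber_def)
  have "i \<in> p ` {1..m}" if i: "i \<in> {1..n}" for i
  proof -
    have "nth_element R i \<in> R" using bij i by (auto simp: bij_betw_def)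
    then have "nth_element R i \<in> {1..m}" "q (nth_element R i) = nth_element R i"
      using R q by (auto simp: retractions_def)
    then show ?thesis using p[OF _ i] by (metis imageI)
  qed
  then show "p ` {1..m} = {1..n}" using pv by blast
  have contracted: "contracted_edges m R q U = {e \<in> image p ` U. card e = 2}" if U: "simple_graph {1..m} U" for U
  proof (intro equalityI subsetI)
    fix e assume "e \<in> contracted_edges m R q U"
    then obtain i j u v where e: "e = {i, j}" "i \<noteq> j" "i \<in> {1..n}" "j \<in> {1..n}" "{u, v} \<in> U"
      "u \<in> {v \<in> {1..m}. p v = i}" "v \<in> {v \<in> {1..m}. p v = j}"
      unfolding contracted_edges_def R(2) using fib by blast
    then have "p ` {u, v} = e" by auto
    then have "e \<in> image p ` U" using e(5) by blast
    then show "e \<in> {e \<in> image p ` U. card e = 2}" using e(1,2) by simp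
  next
    fix e assume "e \<in> {e \<in> image p ` U. card e = 2}"
    then obtain d where d: "d \<in> U" "e = p ` d" "card e = 2" by auto
    then have "d \<subseteq> {1..m}" "card d = 2" using U by (auto simp: simple_graph_def)
    then obtain u v where uv: "d = {u, v}" "u \<in> {1..m}" "v \<in> {1..m}"
      by (auto simp: card_2_iff)
    have "p u \<noteq> p v" using d uv by auto
    moreover have "u \<in> fiber m q (nth_element R (p u))" "v \<in> fiber m q (nth_element R (p v))"
      using fib pv uv by blast+
    ultimately have "{p u, p v} \<in> contracted_edges m R q U"
      unfolding contracted_edges_def R(2) using pv uv d by blast
    then show "e \<in> contracted_edges m R q U" using d uv by simp
  qed
  have fibers: "(\<forall>r\<in>R. P (fiber m q r)) \<longleftrightarrow> (\<forall>i\<in>{1..n}. P {v \<in> {1..m}. p v = i})" for P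
  proof -
    have "R = nth_element R ` {1..n}" using bij by (simp add: bij_betw_def)
    then have "(\<forall>r\<in>R. P (fiber m q r)) \<longleftrightarrow> (\<forall>i\<in>{1..n}. P (fiber m q (nth_element R i)))"
      by (metis (no_types, lifting) imageE imageI)
    then show ?thesis using fib by simp
  qed
  have "(R, q) \<in> displays n T m U \<longleftrightarrow> U \<in> glued_trees p {1..m} {1..n} T"
    if "tree_graph {1..m} U" for U
  proof -
    have "(R, q) \<in> displays n T m U \<longleftrightarrow>
        (\<forall>r\<in>R. tree_graph (fiber m q r) (induced_edges U (fiber m q r))) \<and>
        contracted_edges m R q U = T"
      using R q by (simp add: displays_def retractions_def)
    also have "\<dots> \<longleftrightarrow> U \<in> glued_trees p {1..m} {1..n} T"
      unfolding fibers[of "\<lambda>F. tree_graph F (induced_edges U F)"] glued_trees_def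
      using contracted[of U] that by (simp add: tree_graph_def)
    finally show ?thesis .
  qed
  then show "{U \<in> labeled_trees m. (R, q) \<in> displays n T m U} = glued_trees p {1..m} {1..n} T"
    unfolding labeled_trees_def by (auto simp: glued_trees_def)
qed

lemma card_displayed_trees:
  fixes m :: nat
  assumes T: "T \<in> labeled_trees n"
    and R: "R \<subseteq> {1..m}" "card R = n" and q: "q \<in> retractions {1..m} R"
  defines "b \<equiv> \<lambda>i. card (fiber m q (nth_element R i))"
  shows "card {U \<in> labeled_trees m. (R, q) \<in> displays n T m U} =
    (\<Prod>i=1..n. b i ^ (b i - 2 + degree T i))"
proof -
  have "tree_graph {1..n} T" using T by (simp add: labeled_trees_def)
  from card_glued_trees[OF _ displayed_trees_eq_glued_trees(2)[OF R q] this]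
  show ?thesis
    unfolding displayed_trees_eq_glued_trees(1)[OF R q] b_def
    using displayed_trees_eq_glued_trees(3)[OF R q] by simp
qed

text \<open>
  For \<open>b = 1\<close> the integer exponent may be negative where the natural one is truncated, but powers of \<open>1\<close>
  are \<open>1\<close>.
\<close>
lemma power_eq_powi:
  assumes "b \<ge> 1"
  shows "real (b ^ (b - 2 + d)) = real b powi (int b - 2 + int d)"
proof (cases "b = 1")
  case False
  then have "int b - 2 + int d = int (b - 2 + d)" using assms by simp
  then show ?thesis by (simp only: power_int_of_nat of_nat_power)
qed simp

theorem theorem1p3:
  fixes n m :: nat and T :: "nat set set"
  assumes "T \<in> labeled_trees n" and "n \<le> m"
  shows "real (C1 n T m) =
    real (m choose n) *
      (\<Sum>b\<in>compositions m n.
         multinomial (m - n) {1..n} (\<lambda>i. b i - 1) *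
         (\<Prod>i=1..n. real (b i) powi (int (b i) - 2 + int (degree T i))))"
proof -
  \<comment> \<open>The candidates \<open>(R, q)\<close>, a set independent of \<open>U\<close>, which lets the two sums be exchanged.\<close>
  let ?D = "SIGMA R:{R. R \<subseteq> {1..m} \<and> card R = n}. retractions {1..m} R"
  let ?h = "\<lambda>b. \<Prod>i=1..n. b i ^ (b i - 2 + degree T i)"
  let ?size = "\<lambda>(R, q). \<lambda>i\<in>{1..n}. card (fiber m q (nth_element R i))"
  let ?W = "\<Sum>b\<in>compositions m n. multinomial (m - n) {1..n} (\<lambda>i. b i - 1) * real (?h b)"
  have finR: "finite {R. R \<subseteq> {1..m} \<and> card R = n}" by simp
  have finQ: "finite (retractions {1..m} R)" if "R \<subseteq> {1..m}" for R
    using that by (intro finite_retractions) (auto intro: finite_subset)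
  have "displays n T m U = {d \<in> ?D. d \<in> displays n T m U}" for U
    by (auto simp: displays_def retractions_def)
  then have "C1 n T m = (\<Sum>U\<in>labeled_trees m. card {d \<in> ?D. d \<in> displays n T m U})"
    unfolding C1_def display_count_def by (intro sum.cong) auto
  also have "\<dots> = (\<Sum>d\<in>?D. ?h (?size d))"
  proof (rule sum_multicount_gen)
    show "finite ?D" using finR finQ by (intro finite_SigmaI) auto
    show "\<forall>d\<in>?D. card {U \<in> labeled_trees m. d \<in> displays n T m U} = ?h (?size d)"
      using card_displayed_trees[OF assms(1)] by auto
  qed (rule finite_labeled_trees)
  finally have "real (C1 n T m) = (\<Sum>d\<in>?D. real (?h (?size d)))" by simp
  also have "\<dots> = (\<Sum>R\<in>{R. R \<subseteq> {1..m} \<and> card R = n}. \<Sum>q\<in>retractions {1..m} R.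
      real (?h (?size (R, q))))"
    using finR finQ by (subst sum.Sigma) (auto intro!: sum.cong)
  also have "\<dots> = (\<Sum>R\<in>{R. R \<subseteq> {1..m} \<and> card R = n}. ?W)"
  proof (rule sum.cong)
    fix R assume "R \<in> {R. R \<subseteq> {1..m} \<and> card R = n}"
    then show "(\<Sum>q\<in>retractions {1..m} R. real (?h (?size (R, q)))) = ?W"
      using sum_retractions_by_fiber_sizes[of R m n "\<lambda>b. real (?h b)"] by simp
  qed simp
  also have "\<dots> = real (m choose n) * ?W" by (simp add: n_subsets)
  also have "?W = (\<Sum>b\<in>compositions m n. multinomial (m - n) {1..n} (\<lambda>i. b i - 1) *
         (\<Prod>i=1..n. real (b i) powi (int (b i) - 2 + int (degree T i))))"
  proof (rule sum.cong)
    fix b assume "b \<in> compositions m n"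
    then have "b i \<ge> 1" if "i \<in> {1..n}" for i using that by (auto simp: compositions_def)
    then show "multinomial (m - n) {1..n} (\<lambda>i. b i - 1) * real (?h b) =
        multinomial (m - n) {1..n} (\<lambda>i. b i - 1) *
        (\<Prod>i=1..n. real (b i) powi (int (b i) - 2 + int (degree T i)))"
      using power_eq_powi by (auto simp del: of_nat_power intro!: prod.cong)
  qed simp
  finally show ?thesis .
qed

end
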